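(* Let $a>1$ be an integer, let $k$ be an integer greater than or equal to the quotient $L(a)/M(a)$, and let $n$ be a positive integer bounded by $n\le (a+1)\cdot k$. Then the van der Waerden complex $\mathrm{vdW}(n,k)$ is contractible.
   Context: The van der Waerden complex $\mathrm{vdW}(n,k)$ is the simplicial complex on the vertex set $[n]=\{1,2,\ldots,n\}$ whose facets correspond to all arithmetic progressions of length $k$ in $[n]$, that is, the facets have the form $\{x, x+d, x+2\cdot d, \ldots, x+k\cdot d\}$ (a set with $k+1$ elements), where $d$ is a positive integer and $1\le x<x+k\cdot d\le n$. For an integer $a>1$, let $L(a)=\mathrm{lcm}(1,2,\ldots,a)$, let $L(a)=p_1^{\alpha_1}\cdot p_2^{\alpha_2}\cdots p_m^{\alpha_m}$ be its prime factorization (distinct primes $p_i$, exponents $\alpha_i\ge 1$), and let $M(a)$ be the maximum of the set $\{p_1^{\alpha_1-1},p_2^{\alpha_2-1},\ldots,p_m^{\alpha_m-1}\}$. *)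

theory Defs
  imports
    "HOL-Analysis.Analysis"
    "HOL-Computational_Algebra.Primes"
begin

(* The geometric realization of a finite abstract simplicial complex K: a point is given by its
   barycentric coordinates, and the vertices with nonzero coordinate must form a face of K.  The
   product topology is the usual one for finite K; for infinite K it may be coarser
   than the weak topology. *)
definition realization_carrier :: "'a set set \<Rightarrow> ('a \<Rightarrow> real) set" where
  "realization_carrier K =
     {x. (\<forall>v. 0 \<le> x v) \<and> finite {v. x v \<noteq> 0} \<and> {v. x v \<noteq> 0} \<in> K \<and> (\<Sum>v | x v \<noteq> 0. x v) = 1}"

definition geometric_realization :: "'a set set \<Rightarrow> ('a \<Rightarrow> real) topology" where
  "geometric_realization K = subtopology (powertop_real UNIV) (realization_carrier K)"

(* k counts the steps of the progression, so a facet has k + 1 elements. *)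
definition vdW_facets :: "nat \<Rightarrow> nat \<Rightarrow> nat set set" where
  "vdW_facets n k = {{x + i * d | i. i \<le> k} | x d. 0 < d \<and> 1 \<le> x \<and> x < x + k * d \<and> x + k * d \<le> n}"

(* The empty set is a face as soon as there is a facet.  If n \<le> k there are no facets, hence no
   faces, and the realization is the empty space, which satisfies contractible_space. *)
definition vdW :: "nat \<Rightarrow> nat \<Rightarrow> nat set set" where
  "vdW n k = {S. \<exists>F \<in> vdW_facets n k. S \<subseteq> F}"

definition L :: "nat \<Rightarrow> nat" where
  "L a = Lcm {1..a}"

definition M :: "nat \<Rightarrow> nat" where
  "M a = Max {p ^ (multiplicity p (L a) - 1) | p. p \<in> prime_factors (L a)}"

lemma vdW_facets_subset: "F \<in> vdW_facets n k \<Longrightarrow> F \<subseteq> {1..n}"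
proof
  fix y assume "F \<in> vdW_facets n k" "y \<in> F"
  then obtain x d i where "1 \<le> x" "x + k * d \<le> n" "i \<le> k" "y = x + i * d"
    by (auto simp: vdW_facets_def)
  moreover have "i * d \<le> k * d" using \<open>i \<le> k\<close> by simp
  ultimately have "1 \<le> y" "y \<le> n" by linarith+
  then show "y \<in> {1..n}" by simp
qed

lemma vdW_subset: "S \<in> vdW n k \<Longrightarrow> S \<subseteq> {1..n}"
  using vdW_facets_subset by (fastforce simp: vdW_def)

lemma finite_vdW: "finite (vdW n k)"
  by (rule finite_subset[of _ "Pow {1..n}"]) (use vdW_subset in auto)

lemma vdW_downward_closed: "S \<in> vdW n k \<Longrightarrow> T \<subseteq> S \<Longrightarrow> T \<in> vdW n k"
  by (auto simp: vdW_def)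

lemma card_vdW_facet: "F \<in> vdW_facets n k \<Longrightarrow> card F = k + 1"
proof -
  assume "F \<in> vdW_facets n k"
  then obtain x d where d: "0 < d" and F: "F = {x + i * d | i. i \<le> k}"
    by (auto simp: vdW_facets_def)
  have "F = (\<lambda>i. x + i * d) ` {..k}" using F by auto
  moreover have "inj_on (\<lambda>i. x + i * d) {..k}" using d by (auto simp: inj_on_def)
  ultimately show ?thesis by (simp add: card_image)
qed

lemma vdW_vertices:
  assumes "0 < k" "k < n"
  shows "\<Union> (vdW n k) = {1..n}"
proof
  show "\<Union> (vdW n k) \<subseteq> {1..n}" using vdW_subset by blast
  show "{1..n} \<subseteq> \<Union> (vdW n k)"
  proof
    fix v assume v: "v \<in> {1..n}"
    define x where "x = min v (n - k)"
    have x: "1 \<le> x" "x + k \<le> n" "x \<le> v" "v - x \<le> k" using v assms by (auto simp: x_def)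
    have "{x + i * 1 | i. i \<le> k} \<in> vdW_facets n k"
      unfolding vdW_facets_def using x assms by (intro CollectI exI[of _ x] exI[of _ 1]) auto
    then have "{x + i * 1 | i. i \<le> k} \<in> vdW n k" by (auto simp: vdW_def)
    moreover have "v \<in> {x + i * 1 | i. i \<le> k}" using x by (intro CollectI exI[of _ "v - x"]) auto
    ultimately show "v \<in> \<Union> (vdW n k)" by blast
  qed
qed

(* The maximal faces are exactly the prescribed facets. *)
lemma vdW_maximal_faces: "{S \<in> vdW n k. \<forall>T \<in> vdW n k. S \<subseteq> T \<longrightarrow> S = T} = vdW_facets n k"
proof (intro equalityI subsetI)
  fix S assume "S \<in> {S \<in> vdW n k. \<forall>T \<in> vdW n k. S \<subseteq> T \<longrightarrow> S = T}"
  then show "S \<in> vdW_facets n k" by (auto simp: vdW_def)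
next
  fix S assume S: "S \<in> vdW_facets n k"
  have "S = T" if "T \<in> vdW n k" "S \<subseteq> T" for T
  proof -
    obtain F where F: "F \<in> vdW_facets n k" "T \<subseteq> F" using \<open>T \<in> vdW n k\<close> by (auto simp: vdW_def)
    have "finite F" using vdW_facets_subset[OF F(1)] finite_subset by blast
    then have "S = F" using F that card_vdW_facet[OF S] card_vdW_facet[OF F(1)]
      by (metis card_subset_eq subset_trans)
    then show ?thesis using F that by blast
  qed
  then show "S \<in> {S \<in> vdW n k. \<forall>T \<in> vdW n k. S \<subseteq> T \<longrightarrow> S = T}" using S by (auto simp: vdW_def)
qed

end

theory Submission
  imports Defs
begin

text \<open>Let \<open>n > k\<close>; otherwise there are no faces.  Group the faces by their smallest vertex \<open>s\<close> and largest vertex \<open>t\<close>.  Such a face lies in the complex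
  exactly when some step \<open>d\<close> of a progression through \<open>s\<close> and \<open>t\<close> divides all distances of its
  vertices from \<open>s\<close>.  If \<open>t - s \<ge> 2\<close>, there is a point \<open>s + l\<close> strictly between \<open>s\<close> and \<open>t\<close>, depending
  only on \<open>s\<close> and \<open>t\<close>, that can be added to every face of the group
  (\<open>exists_interior_offset\<close>).  Adding or deleting it matches the faces of the group in pairs, and the
  complex collapses onto the faces with \<open>t - s \<le> 1\<close>, a path on \<open>1, \<dots>, n\<close>, which collapses to a vertex.

  The choice of \<open>l\<close> is where the bound on \<open>k\<close> enters.  Since \<open>n \<le> (a + 1) * k\<close>, all steps are at
  most \<open>a\<close> and divide \<open>L a = p ^ \<alpha> * N\<close>, where \<open>p\<close> is a prime for which \<open>p ^ (\<alpha> - 1) = M a\<close>; the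
  hypothesis becomes \<open>p * N \<le> k\<close>.  When \<open>t - s \<le> k\<close>, the step 1 is available and \<open>l = 1\<close> works.  When
  \<open>t - s\<close> does not divide \<open>L a\<close>, its greatest common divisor with \<open>L a\<close> is a proper divisor of \<open>t - s\<close> and a multiple
  of all steps.  In the remaining case \<open>l = (t - s) / p\<close> works, because a step that does not divide \<open>l\<close>
  can be divided by \<open>p\<close> and still reach from \<open>s\<close> to \<open>t\<close> in \<open>k\<close> steps (\<open>spans_divisor\<close>).

  On the topological side, \<open>elementary_collapse_homotopy_equivalent\<close> realizes one collapse by an explicit
  deformation in barycentric coordinates, and \<open>ranked_toggle_collapse\<close> orders the pairs of a matching
  so that they can be collapsed one after the other.\<close>

section \<open>Collapses of geometric realizations\<close>

definition down_closed :: "'a set set \<Rightarrow> bool" where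
  "down_closed K \<longleftrightarrow> (\<forall>S \<in> K. \<forall>T \<subseteq> S. T \<in> K)"

text \<open>When \<open>\<tau>\<close> is a free face of \<open>\<sigma> = \<tau> \<union> {v}\<close>, the simplex \<open>\<sigma>\<close> can be pushed in from \<open>\<tau>\<close>.  A point loses
  from each vertex of \<open>\<tau>\<close> its smallest coordinate \<open>m\<close> on \<open>\<tau>\<close>, and the lost mass goes to \<open>v\<close>.  As soon
  as the support fails to contain \<open>\<tau>\<close> we have \<open>m = 0\<close>, so the points outside \<open>\<sigma>\<close> and those on the rest of
  its boundary stay fixed.  The push is one formula, continuous because a minimum of finitely many
  coordinates is, and so no gluing of maps along faces is needed.\<close>

lemma elementary_collapse_homotopy_equivalent:
  fixes K :: "'a set set"
  assumes K: "down_closed K" and tau: "finite \<tau>" "\<tau> \<noteq> {}" and v: "v \<notin> \<tau>"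
    and sigma: "insert v \<tau> \<in> K"
    and free: "\<And>H. H \<in> K \<Longrightarrow> \<tau> \<subseteq> H \<Longrightarrow> H = \<tau> \<or> H = insert v \<tau>"
  shows "geometric_realization K homotopy_equivalent_space
           geometric_realization (K - {\<tau>, insert v \<tau>})"
proof -
  define \<sigma> where "\<sigma> = insert v \<tau>"
  define K' where "K' = K - {\<tau>, \<sigma>}"
  define m where "m x = Min (x ` \<tau>)" for x :: "'a \<Rightarrow> real"
  \<comment> \<open>the direction of the push, with coordinate sum zero: out of \<open>\<tau>\<close>, into \<open>v\<close>\<close>
  define c :: "'a \<Rightarrow> real" where "c u = (if u \<in> \<tau> then -1 else if u = v then real (card \<tau>) else 0)" for u
  define h where "h = (\<lambda>(s, x) u. x u + s * (m x * c u))"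
  let ?C = "realization_carrier K" and ?C' = "realization_carrier K'"
  let ?X = "geometric_realization K" and ?Y = "geometric_realization K'"
  have fin: "finite \<sigma>" using tau by (simp add: \<sigma>_def)
  have sum_c: "(\<Sum>u\<in>\<sigma>. c u) = 0"
  proof -
    have "(\<Sum>u\<in>\<tau>. c u) = (\<Sum>u\<in>\<tau>. -1)" by (intro sum.cong) (auto simp: c_def)
    then show ?thesis using tau v by (simp add: \<sigma>_def c_def)
  qed
  have sub: "?C' \<subseteq> ?C" by (auto simp: realization_carrier_def K'_def)
  have m_le: "m x \<le> x u" if "u \<in> \<tau>" for x u using that tau by (simp add: m_def)
  have m_attained: "\<exists>u\<in>\<tau>. x u = m x" for x
  proof -
    have "m x \<in> x ` \<tau>" unfolding m_def using tau by (intro Min_in) auto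
    then show ?thesis by (metis imageE)
  qed
  have m_nonneg: "0 \<le> m x" if "x \<in> ?C" for x
  proof -
    obtain u where "x u = m x" using m_attained by blast
    then show ?thesis using that by (metis (mono_tags, lifting) mem_Collect_eq realization_carrier_def)
  qed
  have supp: "{u. x u \<noteq> 0} \<in> {\<tau>, \<sigma>}" if "x \<in> ?C" "m x \<noteq> 0" for x
  proof -
    have "0 < m x" using m_nonneg that by force
    then have "x u \<noteq> 0" if "u \<in> \<tau>" for u using m_le[OF that, of x] by linarith
    then have "\<tau> \<subseteq> {u. x u \<noteq> 0}" by blast
    moreover have "{u. x u \<noteq> 0} \<in> K" using that by (simp add: realization_carrier_def)
    ultimately show ?thesis using free unfolding \<sigma>_def by blast
  qed
  have m0: "m x = 0" if "x \<in> ?C'" for x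
    using supp[of x] that sub by (auto simp: realization_carrier_def K'_def)
  have in_C: "h (s, x) \<in> ?C" if x: "x \<in> ?C" and s: "0 \<le> s" "s \<le> 1" for s x
  proof (cases "m x = 0")
    case True then show ?thesis using x by (simp add: h_def)
  next
    case False
    define y where "y = h (s, x)"
    have xs: "{u. x u \<noteq> 0} \<subseteq> \<sigma>" using supp[OF x False] by (auto simp: \<sigma>_def)
    have ys: "{u. y u \<noteq> 0} \<subseteq> \<sigma>"
      using xs by (auto simp: y_def h_def c_def \<sigma>_def)
    have nonneg: "0 \<le> y u" for u
    proof -
      have "s * m x \<le> m x" using m_nonneg[OF x] s by (simp add: mult_left_le_one_le)
      moreover have "0 \<le> s * (m x * real (card \<tau>))" using m_nonneg[OF x] s by simp
      moreover have "0 \<le> x u" using x by (simp add: realization_carrier_def)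
      ultimately show ?thesis
        using m_le[of u x] by (auto simp: y_def h_def c_def)
    qed
    have "(\<Sum>u | y u \<noteq> 0. y u) = (\<Sum>u\<in>\<sigma>. y u)"
      using ys fin by (intro sum.mono_neutral_left) auto
    also have "\<dots> = (\<Sum>u\<in>\<sigma>. x u) + s * (m x * (\<Sum>u\<in>\<sigma>. c u))"
      by (simp add: y_def h_def sum.distrib sum_distrib_left)
    also have "\<dots> = (\<Sum>u | x u \<noteq> 0. x u)"
      using xs fin by (simp add: sum_c) (intro sum.mono_neutral_right, auto)
    finally have "(\<Sum>u | y u \<noteq> 0. y u) = 1" using x by (simp add: realization_carrier_def)
    moreover have "{u. y u \<noteq> 0} \<in> K" using ys sigma K by (auto simp: \<sigma>_def down_closed_def)
    moreover have "finite {u. y u \<noteq> 0}" using ys fin finite_subset by blast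
    ultimately show ?thesis using nonneg by (simp add: realization_carrier_def y_def)
  qed
  have in_C': "h (1, x) \<in> ?C'" if x: "x \<in> ?C" for x
  proof -
    obtain u where u: "u \<in> \<tau>" "x u = m x" using m_attained by blast
    then have "h (1, x) u = 0" by (simp add: h_def c_def)
    then have "{u. h (1, x) u \<noteq> 0} \<notin> {\<tau>, \<sigma>}" using u by (auto simp: \<sigma>_def)
    then show ?thesis using in_C[OF x, of 1] by (auto simp: realization_carrier_def K'_def)
  qed
  have top: "topspace ?X = ?C" "topspace ?Y = ?C'"
    by (auto simp: geometric_realization_def)
  have cont_m: "continuous_map (powertop_real UNIV) euclideanreal m"
  proof -
    have "m = (\<lambda>x. INF u\<in>\<tau>. x u)" using tau by (auto simp: m_def cInf_eq_Min)
    then show ?thesis using tau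
      by (auto intro!: continuous_map_Inf continuous_map_product_projection)
  qed
  have cont_h: "continuous_map (prod_topology (top_of_set {0..1}) ?X) ?X h"
  proof -
    have fst: "continuous_map (prod_topology (top_of_set {0..1}) ?X) euclideanreal fst"
      by (metis continuous_map_fst continuous_map_in_subtopology)
    have snd: "continuous_map (prod_topology (top_of_set {0..1}) ?X) (powertop_real UNIV) snd"
      unfolding geometric_realization_def by (metis continuous_map_snd continuous_map_in_subtopology)
    have "continuous_map (prod_topology (top_of_set {0..1}) ?X) euclideanreal (\<lambda>z. h z u)" for u
    proof -
      have 1: "continuous_map (prod_topology (top_of_set {0..1}) ?X) euclideanreal (\<lambda>z. m (snd z))"
        using continuous_map_compose[OF snd cont_m] by (simp add: o_def)
      have 2: "continuous_map (prod_topology (top_of_set {0..1}) ?X) euclideanreal (\<lambda>z. snd z u)"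
        using continuous_map_compose[OF snd continuous_map_product_projection[of u]] by (simp add: o_def)
      show ?thesis unfolding h_def case_prod_unfold
        by (intro continuous_map_add continuous_map_real_mult fst 1 2) simp
    qed
    then show ?thesis
      using in_C by (subst geometric_realization_def)
        (auto simp: continuous_map_in_subtopology continuous_map_componentwise_UNIV top)
  qed
  have cont_r: "continuous_map ?X ?Y (\<lambda>x. h (1, x))"
  proof -
    have "continuous_map ?X (prod_topology (top_of_set {0..1::real}) ?X) (\<lambda>x. (1, x))"
      by (intro continuous_map_pairedI) auto
    from continuous_map_compose[OF this cont_h]
    have "continuous_map ?X ?X (\<lambda>x. h (1, x))" by (simp add: o_def)
    then have "continuous_map ?X (powertop_real UNIV) (\<lambda>x. h (1, x))"
      by (simp add: geometric_realization_def continuous_map_in_subtopology)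
    then show ?thesis using in_C'
      by (subst (2) geometric_realization_def) (auto simp: continuous_map_in_subtopology top)
  qed
  have incl: "continuous_map ?Y ?X id"
    using sub unfolding geometric_realization_def
    by (auto simp: continuous_map_in_subtopology
        intro: continuous_map_from_subtopology[OF continuous_map_id])
  have "homotopic_with (\<lambda>_. True) ?X ?X id (id \<circ> (\<lambda>x. h (1, x)))"
    unfolding homotopic_with_def using cont_h by (intro exI[of _ h]) (auto simp: h_def)
  moreover have "retraction_maps ?X ?Y (\<lambda>x. h (1, x)) id"
    using cont_r incl m0 by (auto simp: retraction_maps_def top h_def)
  ultimately show ?thesis
    using deformation_retraction_imp_homotopy_equivalent_space homotopic_with_symD
    unfolding K'_def \<sigma>_def by blast
qed
lemma finite_set_maximizer:
  fixes f :: "'a \<Rightarrow> nat"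
  assumes "finite S" "S \<noteq> {}"
  obtains x where "x \<in> S" "\<And>y. y \<in> S \<Longrightarrow> f y \<le> f x"
proof -
  have "Max (f ` S) \<in> f ` S" using assms by (intro Max_in) auto
  then obtain x where "x \<in> S" "f x = Max (f ` S)" by auto
  then show thesis using that[of x] assms by simp
qed

text \<open>A discrete Morse argument: the faces outside \<open>K0\<close> are matched by adding or deleting the vertex
  \<open>w G\<close>.  The rank \<open>f\<close> makes the matching acyclic, because among nested faces of equal rank the vertex is the same.
  A face \<open>G\<close> of largest rank, and of largest cardinality for that rank, must contain \<open>w G\<close>, and
  its partner is then a free face of it, so that this pair can be collapsed.  What remains satisfies
  the same hypotheses.\<close>

lemma ranked_toggle_collapse:
  fixes K K0 :: "'a set set" and w :: "'a set \<Rightarrow> 'a" and f :: "'a set \<Rightarrow> nat"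
  assumes "finite K" "\<And>G. G \<in> K \<Longrightarrow> finite G" "down_closed K"
    and K0: "down_closed K0" "K0 \<subseteq> K" "{} \<in> K0"
    and ins: "\<And>G. G \<in> K - K0 \<Longrightarrow> insert (w G) G \<in> K"
    and rem: "\<And>G. G \<in> K - K0 \<Longrightarrow> G - {w G} \<notin> K0"
    and mono: "\<And>G H. G \<in> K - K0 \<Longrightarrow> H \<in> K - K0 \<Longrightarrow> G \<subseteq> H \<Longrightarrow> f G \<le> f H"
    and toggle: "\<And>G. G \<in> K - K0 \<Longrightarrow> f (insert (w G) G) \<le> f (G - {w G})"
    and w: "\<And>G H. G \<in> K - K0 \<Longrightarrow> H \<in> K - K0 \<Longrightarrow> G \<subseteq> H \<Longrightarrow> f G = f H \<Longrightarrow> w G = w H"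
  shows "contractible_space (geometric_realization K) \<longleftrightarrow>
         contractible_space (geometric_realization K0)"
  using assms
proof (induction "card (K - K0)" arbitrary: K rule: less_induct)
  case less
  note finK = less.prems(1) and fin = less.prems(2) and dK = less.prems(3)
    and sub = less.prems(5) and empty = less.prems(6) and ins = less.prems(7)
    and rem = less.prems(8) and mono = less.prems(9)
    and toggle = less.prems(10) and w = less.prems(11)
  have dn: "T \<in> K" if "S \<in> K" "T \<subseteq> S" for S T using dK that by (auto simp: down_closed_def)
  have up: "S \<notin> K0" if "T \<notin> K0" "T \<subseteq> S" for S T
    using less.prems(4) that by (auto simp: down_closed_def)
  have I: "insert (w G) G \<in> K - K0" if "G \<in> K - K0" for G
    using ins[OF that] up[of G "insert (w G) G"] that by blast
  have R: "G - {w G} \<in> K - K0" if "G \<in> K - K0" for G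
    using rem[OF that] dn[of G "G - {w G}"] that by blast
  have fI: "f (insert (w G) G) = f G" "f (G - {w G}) = f G" if G: "G \<in> K - K0" for G
    using mono[OF R[OF G] G Diff_subset] mono[OF G I[OF G] subset_insertI] toggle[OF G] by linarith+
  show ?case
  proof (cases "K - K0 = {}")
    case True
    then show ?thesis using sub by (metis Diff_eq_empty_iff subset_antisym)
  next
    case False
    have finD: "finite (K - K0)" using finK by simp
    obtain G0 where G0: "G0 \<in> K - K0" "\<And>H. H \<in> K - K0 \<Longrightarrow> f H \<le> f G0"
      using finite_set_maximizer[OF finD False, of f] by blast
    define D where "D = {H \<in> K - K0. f H = f G0}"
    have "finite D" using finD by (rule rev_finite_subset) (auto simp: D_def)
    moreover have "D \<noteq> {}" using G0(1) by (auto simp: D_def)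
    ultimately obtain G where "G \<in> D" "\<And>H. H \<in> D \<Longrightarrow> card H \<le> card G"
      using finite_set_maximizer by metis
    then have G: "G \<in> K - K0" and fmax: "\<And>H. H \<in> K - K0 \<Longrightarrow> f H \<le> f G"
      and cmax: "\<And>H. H \<in> K - K0 \<Longrightarrow> f H = f G \<Longrightarrow> card H \<le> card G"
      using G0(2) by (auto simp: D_def)
    define v where "v = w G"
    define \<tau> where "\<tau> = G - {v}"
    have finG: "finite G" using fin G by blast
    have "card (insert v G) \<le> card G" using cmax[OF I[OF G]] fI[OF G] by (simp add: v_def)
    then have vG: "v \<in> G" using finG by (metis card_insert_disjoint not_less_eq_eq order_refl)
    then have Gt: "G = insert v \<tau>" and vt: "v \<notin> \<tau>" by (auto simp: \<tau>_def)
    have t: "\<tau> \<in> K - K0" "f \<tau> = f G" using R[OF G] fI[OF G] by (auto simp: \<tau>_def v_def)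
    have wt: "w \<tau> = v" using w[OF t(1) G] t(2) by (auto simp: v_def \<tau>_def)
    have fint: "finite \<tau>" using finG by (simp add: \<tau>_def)
    have cG: "card G = Suc (card \<tau>)" using Gt vt fint by simp
    have free: "H = \<tau> \<or> H = insert v \<tau>" if H: "H \<in> K" "\<tau> \<subseteq> H" for H
    proof (rule ccontr)
      assume neg: "\<not> ?thesis"
      have H0: "H \<in> K - K0" using H up t(1) by blast
      have fH: "f H = f G" using mono[OF t(1) H0 H(2)] fmax[OF H0] t(2) by simp
      have wH: "w H = v" using w[OF t(1) H0 H(2)] fH t(2) wt by simp
      have finH: "finite H" using fin H by blast
      have ct: "card \<tau> < card H" using neg H(2) finH by (intro psubset_card_mono) auto
      have "card (insert v H) \<le> card G"
        using cmax[OF I[OF H0]] fI(1)[OF H0] fH wH by simp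
      then have "v \<in> H" using ct cG finH by (cases "v \<in> H") auto
      then have "G \<subseteq> H" using H(2) Gt by blast
      moreover have "card H \<le> card G" using cmax[OF H0 fH] .
      ultimately have "G = H" using finH by (metis card_seteq)
      then show False using neg Gt by blast
    qed
    define K' where "K' = K - {\<tau>, insert v \<tau>}"
    have "geometric_realization K homotopy_equivalent_space geometric_realization K'"
      unfolding K'_def
    proof (rule elementary_collapse_homotopy_equivalent)
      show "\<tau> \<noteq> {}" using t(1) empty by blast
      show "insert v \<tau> \<in> K" using G Gt by blast
    qed (use dK fint vt free in blast)+
    then have "contractible_space (geometric_realization K) \<longleftrightarrow>
               contractible_space (geometric_realization K')"
      by (rule homotopy_equivalent_space_contractibility)
    also have "\<dots> \<longleftrightarrow> contractible_space (geometric_realization K0)"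
    proof (rule less.hyps)
      have D': "K' - K0 \<subseteq> K - K0" and G': "G \<notin> K'" by (auto simp: K'_def Gt)
      have "K' - K0 \<subset> K - K0" using D' G' G by blast
      then show "card (K' - K0) < card (K - K0)" using finD by (rule psubset_card_mono[rotated])
      show "finite K'" using finK by (simp add: K'_def)
      show "\<And>G. G \<in> K' \<Longrightarrow> finite G" using fin by (simp add: K'_def)
      show "down_closed K'"
        unfolding down_closed_def
      proof (intro ballI allI impI)
        fix S T assume S: "S \<in> K'" "T \<subseteq> S"
        then have "S \<in> K" "S \<noteq> \<tau>" "S \<noteq> insert v \<tau>" by (auto simp: K'_def)
        then have "\<not> \<tau> \<subseteq> S" using free by blast
        moreover have "T \<in> K" using dn[OF \<open>S \<in> K\<close> S(2)] .
        ultimately show "T \<in> K'" using S(2) by (auto simp: K'_def)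
      qed
      show "down_closed K0" by fact
      show "K0 \<subseteq> K'" using sub t(1) G Gt by (auto simp: K'_def)
      show "{} \<in> K0" by fact
      \<comment> \<open>a face whose partner has been removed has toggle vertex \<open>v\<close>, so it has been removed too\<close>
      show "insert (w H) H \<in> K'" if "H \<in> K' - K0" for H
      proof (rule ccontr)
        assume neg: "insert (w H) H \<notin> K'"
        have H: "H \<in> K - K0" using that D' by blast
        then have e: "insert (w H) H = \<tau> \<or> insert (w H) H = G"
          using neg I[OF H] by (auto simp: K'_def Gt)
        have "w H = w (insert (w H) H)" using w[OF H I[OF H]] fI(1)[OF H] by auto
        then have "w H = v" using e wt v_def by metis
        then have "insert v H = G" using e vt by auto
        then have "H = G \<or> H = \<tau>" by (auto simp: \<tau>_def)
        then show False using that by (auto simp: K'_def Gt)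
      qed
      show "H - {w H} \<notin> K0" if "H \<in> K' - K0" for H
        using rem that D' by blast
      show "f G \<le> f H" if "G \<in> K' - K0" "H \<in> K' - K0" "G \<subseteq> H" for G H
        using mono that D' by blast
      show "f (insert (w H) H) \<le> f (H - {w H})" if "H \<in> K' - K0" for H
        using toggle that D' by blast
      show "w G = w H" if "G \<in> K' - K0" "H \<in> K' - K0" "G \<subseteq> H" "f G = f H" for G H
        using w that D' by blast
    qed
    finally show ?thesis .
  qed
qed

lemma contractible_geometric_realization_vertex:
  "contractible_space (geometric_realization {{}, {v}})"
proof -
  have "realization_carrier {{}, {v}} \<subseteq> {\<lambda>u. if u = v then 1 else 0}"
  proof
    fix x assume x: "x \<in> realization_carrier {{}, {v}}"
    then have s: "(\<Sum>u | x u \<noteq> 0. x u) = 1" and "{u. x u \<noteq> 0} = {} \<or> {u. x u \<noteq> 0} = {v}"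
      by (auto simp: realization_carrier_def)
    then have e: "{u. x u \<noteq> 0} = {v}" by force
    then have "x v = 1" using s by simp
    moreover have "x u = 0" if "u \<noteq> v" for u using e that by blast
    ultimately show "x \<in> {\<lambda>u. if u = v then 1 else 0}" by auto
  qed
  moreover have "(\<lambda>u. if u = v then 1 else 0) \<in> realization_carrier {{}, {v}}"
    by (auto simp: realization_carrier_def)
  ultimately have "realization_carrier {{}, {v}} = {\<lambda>u. if u = v then 1 else 0}" by blast
  then show ?thesis by (simp add: geometric_realization_def)
qed

section \<open>Steps of progressions through two given points\<close>

text \<open>The points \<open>s \<le> t\<close> lie on a common facet of step \<open>d\<close>.  For a face this condition on its two
  extreme vertices separates the requirement that the progression fits into \<open>{1..n}\<close> from the
  divisibility by \<open>d\<close>, which is all that the inner vertices have to satisfy.\<close>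

definition spans :: "nat \<Rightarrow> nat \<Rightarrow> nat \<Rightarrow> nat \<Rightarrow> nat \<Rightarrow> bool" where
  "spans n k d s t \<longleftrightarrow> 0 < d \<and>
     (\<exists>x i j. 1 \<le> x \<and> x + k * d \<le> n \<and> s = x + i * d \<and> t = x + j * d \<and> i \<le> j \<and> j \<le> k)"

lemma vdW_face_iff_spans:
  assumes G: "finite G" "G \<noteq> {}" and k: "0 < k"
  shows "G \<in> vdW n k \<longleftrightarrow> (\<exists>d. spans n k d (Min G) (Max G) \<and> (\<forall>g\<in>G. d dvd g - Min G))"
proof
  assume "G \<in> vdW n k"
  then obtain x d where d: "0 < d" "1 \<le> x" "x + k * d \<le> n" and sub: "G \<subseteq> {x + i * d | i. i \<le> k}"
    by (auto simp: vdW_def vdW_facets_def)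
  have m: "Min G \<in> G" "Max G \<in> G" "Min G \<le> Max G" using G by auto
  obtain i where i: "Min G = x + i * d" "i \<le> k" using m sub by blast
  obtain j where j: "Max G = x + j * d" "j \<le> k" using m sub by blast
  have "i \<le> j" using m(3) i j d by simp
  then have "spans n k d (Min G) (Max G)" using d i j unfolding spans_def by blast
  moreover have "d dvd g - Min G" if g: "g \<in> G" for g
  proof -
    obtain l where "g = x + l * d" using sub g by blast
    then have "g - Min G = (l - i) * d" using i by (simp add: diff_mult_distrib)
    then show ?thesis by simp
  qed
  ultimately show "\<exists>d. spans n k d (Min G) (Max G) \<and> (\<forall>g\<in>G. d dvd g - Min G)" by blast
next
  assume "\<exists>d. spans n k d (Min G) (Max G) \<and> (\<forall>g\<in>G. d dvd g - Min G)"
  then obtain d x i j where d: "0 < d" "1 \<le> x" "x + k * d \<le> n"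
    and ij: "Min G = x + i * d" "Max G = x + j * d" "j \<le> k" and dv: "\<forall>g\<in>G. d dvd g - Min G"
    unfolding spans_def by blast
  have "g \<in> {x + i * d | i. i \<le> k}" if g: "g \<in> G" for g
  proof -
    have b: "Min G \<le> g" "g \<le> Max G" using G g by auto
    obtain c where "g - Min G = d * c" using dv g by blast
    then have e: "g = x + (i + c) * d" using b ij by (simp add: algebra_simps)
    then have "(i + c) * d \<le> j * d" using b ij by linarith
    then have "i + c \<le> k" using d ij by simp
    then show ?thesis using e by blast
  qed
  then have "G \<subseteq> {x + i * d | i. i \<le> k}" by blast
  moreover have "x < x + k * d" using d k by simp
  then have "{x + i * d | i. i \<le> k} \<in> vdW_facets n k" using d unfolding vdW_facets_def by blast
  ultimately show "G \<in> vdW n k" unfolding vdW_def by blast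
qed

text \<open>Passing to a divisor \<open>e\<close> of a step makes the progression shorter, so only its length is an
  obstacle, not its position in \<open>{1..n}\<close>: let it start at \<open>s\<close> or end at \<open>t\<close>.  If both left the
  interval, then \<open>s \<le> t \<le> k * e\<close> and \<open>n < s + k * e \<le> 2 * k * e \<le> k * (p * e)\<close>, but a progression of step
  \<open>p * e\<close> does fit.\<close>

lemma spans_divisor:
  assumes "spans n k (p * e) s t" "2 \<le> p" "t - s \<le> k * e"
  shows "spans n k e s t"
proof -
  obtain x i j where x: "0 < p * e" "1 \<le> x" "x + k * (p * e) \<le> n" "s = x + i * (p * e)"
      "t = x + j * (p * e)" "i \<le> j" "j \<le> k"
    using assms(1) unfolding spans_def by blast
  define q where "q = (j - i) * p"
  have e: "0 < e" using x by simp
  have tq: "t = s + q * e"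
  proof -
    have "j * (p * e) = i * (p * e) + (j - i) * (p * e)" using x(6) by (simp flip: add_mult_distrib)
    then show ?thesis using x by (simp add: q_def mult.assoc)
  qed
  then have "q * e \<le> k * e" using assms(3) by simp
  then have q: "q \<le> k" using e by simp
  have "j * (p * e) \<le> k * (p * e)" using x(7) by (rule mult_le_mono1)
  then have tn: "t \<le> n" using x by linarith
  show ?thesis
  proof (cases "s + k * e \<le> n")
    case True
    show ?thesis unfolding spans_def
      using e True x q tq by (intro conjI exI[of _ s] exI[of _ 0] exI[of _ q]) auto
  next
    case False
    have "2 * (k * e) \<le> p * (k * e)" using assms(2) by (rule mult_le_mono1)
    then have "2 * (k * e) \<le> k * (p * e)" by (simp add: ac_simps)
    then have big: "k * e < t" using False x(2,3) tq by linarith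
    have "k * e = (k - q) * e + q * e" using q by (simp flip: add_mult_distrib)
    then have "s = (t - k * e) + (k - q) * e" using big tq by linarith
    moreover have "1 \<le> t - k * e" "t = (t - k * e) + k * e" "(t - k * e) + k * e \<le> n"
      using big tn by linarith+
    ultimately show ?thesis unfolding spans_def using e diff_le_self by blast
  qed
qed

lemma spans_dvd:
  assumes "spans n k d s t"
  shows "d dvd t - s"
proof -
  obtain x i j where "s = x + i * d" "t = x + j * d" using assms unfolding spans_def by blast
  then have "t - s = (j - i) * d" by (simp add: diff_mult_distrib)
  then show ?thesis by simp
qed

text \<open>The arithmetic heart.  The bound on \<open>n\<close> forces every step to be at most \<open>a\<close>, hence to divide
  \<open>p ^ \<alpha> * N\<close>, a number that \<open>dvd\<close> asks to be a common multiple of \<open>1, \<dots>, a\<close>.  The offset \<open>l\<close>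
  is such that every step has a refinement \<open>d'\<close> that is a step as well and divides \<open>l\<close>.  Then the point
  \<open>s + l\<close> can be added to any face with extreme vertices \<open>s\<close> and \<open>t\<close>, and \<open>l\<close> depends on \<open>s\<close> and \<open>t\<close>
  only.\<close>

lemma exists_interior_offset:
  assumes p: "prime p" and N: "0 < N" "p * N \<le> k" and n: "n \<le> (a + 1) * k"
    and dvd: "\<And>d. 0 < d \<Longrightarrow> d \<le> a \<Longrightarrow> d dvd p ^ \<alpha> * N"
    and long: "2 \<le> t - s"
  shows "\<exists>l. 0 < l \<and> l < t - s \<and>
    (\<forall>d. spans n k d s t \<longrightarrow> (\<exists>d'. spans n k d' s t \<and> d' dvd d \<and> d' dvd l))"
proof -
  have p2: "2 \<le> p" using p by (rule prime_ge_2_nat)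
  have step: "d dvd p ^ \<alpha> * N" if "spans n k d s t" for d
  proof (rule dvd)
    show "0 < d" using that by (simp add: spans_def)
    have "1 + k * d \<le> n" using that unfolding spans_def by force
    then have "k * d < k * (a + 1)" using n by (simp add: mult.commute)
    then show "d \<le> a" using mult_le_mono2[of "a + 1" d k] by linarith
  qed
  consider "t - s \<le> k" | "\<not> t - s dvd p ^ \<alpha> * N" | "k < t - s" "t - s dvd p ^ \<alpha> * N"
    by linarith
  then show ?thesis
  proof cases
    \<comment> \<open>the points are so close that a progression of step 1 contains both\<close>
    case 1
    have "spans n k 1 s t" if d: "spans n k d s t" for d
    proof (cases "d = 1")
      case True then show ?thesis using d by simp
    next
      case False
      then have "2 \<le> d" using d by (simp add: spans_def)
      then show ?thesis using spans_divisor[of n k d 1 s t] d 1 by simp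
    qed
    then show ?thesis using long by (intro exI[of _ 1]) auto
  next
    \<comment> \<open>the common multiples of all steps include a proper divisor of \<open>t - s\<close>\<close>
    case 2
    define l where "l = gcd (t - s) (p ^ \<alpha> * N)"
    have "l dvd t - s" "l dvd p ^ \<alpha> * N" by (simp_all add: l_def)
    then have "l \<noteq> t - s" "l \<le> t - s" "0 < l" using 2 long by (auto intro: dvd_imp_le gr0I)
    moreover have "d dvd l" if "spans n k d s t" for d
      using step[OF that] spans_dvd[OF that] by (simp add: l_def)
    ultimately show ?thesis by (intro exI[of _ l]) auto
  next
    \<comment> \<open>Here \<open>l = (t - s) / p\<close>.  Among the steps dividing \<open>d\<close> take the least one, \<open>d'\<close>.  If it did not
      divide \<open>l\<close>, it would contain the full power of \<open>p\<close> in \<open>t - s\<close>, its cofactor \<open>c\<close> would divide \<open>N\<close>,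
      and \<open>p * c \<le> p * N \<le> k\<close> would make \<open>d' / p\<close> a smaller step.\<close>
    case 3
    have pd: "p dvd t - s"
    proof (rule ccontr)
      assume np: "\<not> p dvd t - s"
      have "coprime (t - s) (p ^ \<alpha>)"
        using prime_imp_coprime[OF p np] by (simp add: coprime_commute)
      then have "t - s dvd N" using 3(2) by (simp add: coprime_dvd_mult_right_iff)
      then have "t - s \<le> N" using N(1) by (rule dvd_imp_le)
      also have "N \<le> p * N" using p2 by simp
      finally show False using N 3(1) by simp
    qed
    then obtain l where l: "t - s = p * l" by blast
    have "\<exists>d'. spans n k d' s t \<and> d' dvd d \<and> d' dvd l" if d: "spans n k d s t" for d
    proof -
      define d' where "d' = (LEAST e. spans n k e s t \<and> e dvd d)"
      have d': "spans n k d' s t" "d' dvd d"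
        using LeastI[of "\<lambda>e. spans n k e s t \<and> e dvd d" d] d by (auto simp: d'_def)
      have least: "d' \<le> e" if "spans n k e s t" "e dvd d" for e
        unfolding d'_def using that by (intro Least_le) auto
      have "d' dvd l"
      proof (rule ccontr)
        assume neg: "\<not> d' dvd l"
        obtain c where c: "t - s = d' * c" using spans_dvd[OF d'(1)] by blast
        have pc: "\<not> p dvd c"
        proof
          assume "p dvd c"
          then obtain b where "c = p * b" by blast
          then have "p * l = p * (d' * b)" using l c by (metis mult.left_commute)
          then have "l = d' * b" using p2 by simp
          then show False using neg by simp
        qed
        then have "p dvd d'" using pd c p by (simp add: prime_dvd_mult_iff)
        then obtain e where e: "d' = p * e" by blast
        have "coprime c (p ^ \<alpha>)"
          using prime_imp_coprime[OF p pc] by (simp add: coprime_commute)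
        moreover have "c dvd p ^ \<alpha> * N" using 3(2) c by (metis dvd_mult_right)
        ultimately have "c dvd N" by (simp add: coprime_dvd_mult_right_iff)
        then have "c \<le> N" using N(1) by (rule dvd_imp_le)
        then have "p * c \<le> k" using N(2) by (meson le_trans mult_le_mono2)
        then have "t - s \<le> k * e" using c e by (metis mult.assoc mult.commute mult_le_mono1)
        then have "spans n k e s t" using spans_divisor d'(1) e p2 by blast
        moreover have "e dvd d" using d'(2) e by (metis dvd_mult_right)
        ultimately have "p * e \<le> e" using least e by blast
        moreover have "0 < e" using d'(1) e by (simp add: spans_def)
        ultimately show False using p2 by simp
      qed
      then show ?thesis using d' by blast
    qed
    moreover have "0 < l" "l < t - s" using l long p2 by (auto intro: gr0I)
    ultimately show ?thesis by blast
  qed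
qed

section \<open>Contractibility of the van der Waerden complex\<close>

lemma finite_vdW_face: "G \<in> vdW n k \<Longrightarrow> finite G"
  by (rule finite_subset[OF vdW_subset]) auto

lemma down_closed_vdW: "down_closed (vdW n k)"
  unfolding down_closed_def using vdW_downward_closed by blast

text \<open>These faces have no room for a vertex strictly between their extremes; they form a path.\<close>

definition short_faces :: "nat \<Rightarrow> nat \<Rightarrow> nat set set" where
  "short_faces n k = {G \<in> vdW n k. G = {} \<or> Max G \<le> Min G + 1}"

lemma down_closed_short_faces: "down_closed (short_faces n k)"
  unfolding down_closed_def
proof (intro ballI allI impI)
  fix S T assume S: "S \<in> short_faces n k" and T: "T \<subseteq> S"
  have fin: "finite S" using S finite_vdW_face by (auto simp: short_faces_def)
  show "T \<in> short_faces n k"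
  proof (cases "T = {}")
    case True
    then show ?thesis using S vdW_downward_closed[of S n k "{}"] by (simp add: short_faces_def)
  next
    case False
    then have "Max T \<le> Max S" "Min S \<le> Min T" using T fin by (auto intro: Max_mono Min_antimono)
    then show ?thesis using S T False vdW_downward_closed[of S n k T]
      by (auto simp: short_faces_def)
  qed
qed

text \<open>The path is shrunk from its far end: the vertex \<open>b > 1\<close> is matched with the edge \<open>{b - 1, b}\<close>.\<close>

lemma contractible_short_faces:
  assumes "0 < k" "k < n"
  shows "contractible_space (geometric_realization (short_faces n k))"
proof -
  have edge: "{b - 1, b} \<in> vdW n k" if "2 \<le> b" "b \<le> n" for b
  proof -
    define x where "x = min (b - 1) (n - k)"
    have x: "1 \<le> x" "x + k \<le> n" "x \<le> b - 1" "b \<le> x + k"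
      using that assms by (auto simp: x_def)
    have "spans n k 1 (b - 1) b" unfolding spans_def
      using x that by (intro conjI exI[of _ x] exI[of _ "b - 1 - x"] exI[of _ "b - x"]) auto
    then show ?thesis using that assms by (subst vdW_face_iff_spans) (auto intro!: exI[of _ 1])
  qed
  have dim1: "finite G" "2 \<le> Max G" "Max G \<le> n" "Max G \<in> G" "G \<subseteq> {Max G - 1, Max G}"
    if G: "G \<in> short_faces n k - {{}, {1}}" for G
  proof -
    show fin: "finite G" using G finite_vdW_face by (auto simp: short_faces_def)
    have ne: "G \<noteq> {}" "G \<noteq> {1}" using G by auto
    show mx: "Max G \<in> G" using fin ne by simp
    have sub: "G \<subseteq> {1..n}" using G vdW_subset by (auto simp: short_faces_def)
    then show "Max G \<le> n" using mx by auto
    have "Max G \<le> Min G + 1" using G by (auto simp: short_faces_def)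
    then have "Max G \<le> g + 1 \<and> g \<le> Max G" if "g \<in> G" for g
      using Min_le[OF fin that] Max_ge[OF fin that] by linarith
    then show "G \<subseteq> {Max G - 1, Max G}" by force
    show "2 \<le> Max G"
    proof (rule ccontr)
      assume "\<not> 2 \<le> Max G"
      then have "g = 1" if "g \<in> G" for g using Max_ge[OF fin that] sub that by force
      then show False using ne by blast
    qed
  qed
  have one: "{1} \<in> vdW n k"
    using edge[of 2] assms vdW_downward_closed[of "{1, 2}" n k "{1}"] by force
  have "contractible_space (geometric_realization (short_faces n k)) \<longleftrightarrow>
        contractible_space (geometric_realization {{}, {1::nat}})"
  proof (rule ranked_toggle_collapse[where w = "\<lambda>G. Max G - 1" and f = Max])
    show "finite (short_faces n k)" using finite_vdW by (simp add: short_faces_def)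
    show "\<And>G. G \<in> short_faces n k \<Longrightarrow> finite G" using finite_vdW_face by (auto simp: short_faces_def)
    show "down_closed (short_faces n k)" by (rule down_closed_short_faces)
    show "down_closed {{}, {1::nat}}" by (auto simp: down_closed_def)
    show "{{}, {1}} \<subseteq> short_faces n k"
      using one vdW_downward_closed[OF one, of "{}"] by (auto simp: short_faces_def)
    fix G assume G: "G \<in> short_faces n k - {{}, {1}}"
    define b where "b = Max G"
    have b: "2 \<le> b" "b \<le> n" "b \<in> G" "G \<subseteq> {b - 1, b}" using dim1[OF G] by (auto simp: b_def)
    have i: "insert (b - 1) G = {b - 1, b}" and r: "G - {b - 1} = {b}" using b by auto
    show "insert (Max G - 1) G \<in> short_faces n k"
      using i b edge[of b] by (simp add: short_faces_def flip: b_def)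
    show "G - {Max G - 1} \<notin> {{}, {1}}" using r b by (simp flip: b_def)
    show "Max (insert (Max G - 1) G) \<le> Max (G - {Max G - 1})"
      using i r by (simp flip: b_def)
  next
    fix G H assume "G \<in> short_faces n k - {{}, {1}}" "H \<in> short_faces n k - {{}, {1}}" "G \<subseteq> H"
    then show "Max G \<le> Max H" using dim1(1) by (intro Max_mono) auto
  qed auto
  then show ?thesis by (simp add: contractible_geometric_realization_vertex)
qed

text \<open>Faces that are not short are matched by the vertex at the interior offset of their two extreme
  vertices.  Toggling an inner vertex keeps the extremes, and nested faces of equal diameter have
  the same extremes, so that the diameter serves as rank.\<close>

lemma contractible_vdW:
  assumes p: "prime p" and N: "0 < N" "p * N \<le> k" and n: "n \<le> (a + 1) * k"
    and dvd: "\<And>d. 0 < d \<Longrightarrow> d \<le> a \<Longrightarrow> d dvd p ^ \<alpha> * N"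
    and kn: "k < n"
  shows "contractible_space (geometric_realization (vdW n k))"
proof -
  have "0 < p * N" using prime_gt_0_nat[OF p] N(1) by simp
  then have k: "0 < k" using N(2) by linarith
  define good where "good s t l \<longleftrightarrow> 0 < l \<and> l < t - s \<and>
    (\<forall>d. spans n k d s t \<longrightarrow> (\<exists>d'. spans n k d' s t \<and> d' dvd d \<and> d' dvd l))" for s t l
  define w where "w G = Min G + (SOME l. good (Min G) (Max G) l)" for G
  let ?D = "vdW n k - short_faces n k"
  have good: "good (Min G) (Max G) (w G - Min G)" if "2 \<le> Max G - Min G" for G
  proof -
    have "\<exists>l. good (Min G) (Max G) l"
      unfolding good_def by (rule exists_interior_offset[OF p N n dvd that])
    then have "good (Min G) (Max G) (SOME l. good (Min G) (Max G) l)" by (rule someI_ex)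
    then show ?thesis by (simp add: w_def)
  qed
  have fin: "finite G" and ne: "G \<noteq> {}" and long: "2 \<le> Max G - Min G" if "G \<in> ?D" for G
    using that finite_vdW_face by (auto simp: short_faces_def)
  have inner: "Min G < w G" "w G < Max G" if "G \<in> ?D" for G
    using good[OF long[OF that]] by (auto simp: good_def)
  have ends: "Min (insert (w G) G) = Min G" "Max (insert (w G) G) = Max G"
      "Min (G - {w G}) = Min G" "Max (G - {w G}) = Max G" if G: "G \<in> ?D" for G
  proof -
    show "Min (insert (w G) G) = Min G" "Max (insert (w G) G) = Max G"
      using inner[OF G] fin[OF G] ne[OF G] by auto
    have "Min G \<in> G" "Max G \<in> G" using fin[OF G] ne[OF G] by auto
    then show "Min (G - {w G}) = Min G" "Max (G - {w G}) = Max G"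
      using inner[OF G] fin[OF G] by (auto intro!: Min_eqI Max_eqI)
  qed
  have incr: "Min H \<le> Min G" "Max G \<le> Max H" "Min G \<le> Max G" if "G \<in> ?D" "H \<in> ?D" "G \<subseteq> H" for G H
  proof -
    show "Min H \<le> Min G" using that ne fin by (intro Min_antimono) auto
    show "Max G \<le> Max H" using that ne fin by (intro Max_mono) auto
    show "Min G \<le> Max G" using long[OF that(1)] by linarith
  qed
  have "contractible_space (geometric_realization (vdW n k)) \<longleftrightarrow>
        contractible_space (geometric_realization (short_faces n k))"
  proof (rule ranked_toggle_collapse[where w = w and f = "\<lambda>G. Max G - Min G"])
    show "finite (vdW n k)" by (rule finite_vdW)
    show "\<And>G. G \<in> vdW n k \<Longrightarrow> finite G" by (rule finite_vdW_face)
    show "down_closed (vdW n k)" by (rule down_closed_vdW)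
    show "down_closed (short_faces n k)" by (rule down_closed_short_faces)
    show "short_faces n k \<subseteq> vdW n k" by (auto simp: short_faces_def)
    have "\<Union> (vdW n k) \<noteq> {}" using vdW_vertices[OF k kn] kn by auto
    then obtain S where "S \<in> vdW n k" by blast
    then have "{} \<in> vdW n k" using vdW_downward_closed by blast
    then show "{} \<in> short_faces n k" by (simp add: short_faces_def)
  next
    fix G assume G: "G \<in> ?D"
    obtain d where d: "spans n k d (Min G) (Max G)" "\<forall>g\<in>G. d dvd g - Min G"
      using G vdW_face_iff_spans[OF fin[OF G] ne[OF G] k] by blast
    obtain d' where d': "spans n k d' (Min G) (Max G)" "d' dvd d" "d' dvd w G - Min G"
      using good[OF long[OF G]] d(1) by (auto simp: good_def)
    have "\<forall>g\<in>insert (w G) G. d' dvd g - Min G" using d(2) d'(2,3) dvd_trans by blast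
    then show "insert (w G) G \<in> vdW n k"
      using d'(1) ends[OF G] fin[OF G] k by (subst vdW_face_iff_spans) auto
    have "Min G \<in> G - {w G}" using fin[OF G] ne[OF G] inner[OF G] by auto
    then show "G - {w G} \<notin> short_faces n k"
      using ends[OF G] long[OF G] by (auto simp: short_faces_def)
    show "Max (insert (w G) G) - Min (insert (w G) G) \<le> Max (G - {w G}) - Min (G - {w G})"
      using ends[OF G] by simp
  next
    fix G H assume GH: "G \<in> ?D" "H \<in> ?D" "G \<subseteq> H"
    show "Max G - Min G \<le> Max H - Min H" using incr[OF GH] by linarith
    assume "Max G - Min G = Max H - Min H"
    then have "Min G = Min H" "Max G = Max H" using incr[OF GH] by linarith+
    then show "w G = w H" by (simp add: w_def)
  qed
  then show ?thesis using contractible_short_faces[OF k kn] by simp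
qed

theorem theorem4p4:
  fixes a k n :: nat
  assumes "a > 1"
    and "real k \<ge> real (L a) / real (M a)"
    and "n > 0"
    and "n \<le> (a + 1) * k"
  shows "contractible_space (geometric_realization (vdW n k))"
proof (cases "k < n")
  case False
  \<comment> \<open>there is no facet, and the realization is the empty space\<close>
  have "vdW_facets n k = {}"
  proof -
    have "\<not> x + k * d \<le> n" if "0 < d" "1 \<le> x" for x d :: nat
    proof -
      have "k \<le> k * d" using that by simp
      then show ?thesis using False that by linarith
    qed
    then show ?thesis by (auto simp: vdW_facets_def)
  qed
  then have "realization_carrier (vdW n k) = {}" by (simp add: vdW_def realization_carrier_def)
  then show ?thesis by (simp add: geometric_realization_def)
next
  case True
  have La: "L a \<noteq> 0" by (simp add: L_def Lcm_0_iff)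
  have "2 dvd L a" unfolding L_def using assms(1) by (intro dvd_Lcm) auto
  then have ne: "2 \<in> prime_factors (L a)" using La by (auto simp: prime_factors_dvd)
  let ?S = "{p ^ (multiplicity p (L a) - 1) | p. p \<in> prime_factors (L a)}"
  have "?S = (\<lambda>p. p ^ (multiplicity p (L a) - 1)) ` prime_factors (L a)" by auto
  then have "M a \<in> ?S" unfolding M_def using ne by (intro Max_in) auto
  then obtain p where p: "p \<in> prime_factors (L a)" "M a = p ^ (multiplicity p (L a) - 1)" by blast
  define \<alpha> where "\<alpha> = multiplicity p (L a)"
  obtain N where N: "L a = p ^ \<alpha> * N" unfolding \<alpha>_def using multiplicity_dvd by blast
  have pr: "prime p" using p(1) by auto
  have "0 < \<alpha>" using p(1) by (simp add: \<alpha>_def prime_factors_multiplicity)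
  \<comment> \<open>for a prime \<open>p\<close> attaining the maximum \<open>M a\<close>, the quotient \<open>L a / M a\<close> is the integer \<open>p * N\<close>\<close>
  then obtain b where b: "\<alpha> = Suc b" using not0_implies_Suc by blast
  have "M a = p ^ b" using p(2) b by (simp flip: \<alpha>_def)
  then have "L a = M a * (p * N)" using N b by simp
  moreover have "0 < M a" using p(2) prime_gt_0_nat[OF pr] by simp
  ultimately have "real (L a) / real (M a) = real (p * N)" by simp
  then have "p * N \<le> k" using assms(2) by linarith
  moreover have "0 < N" using N La by (intro gr0I) auto
  moreover have "d dvd p ^ \<alpha> * N" if "0 < d" "d \<le> a" for d
    unfolding N[symmetric] L_def using that by (intro dvd_Lcm) auto
  ultimately show ?thesis using contractible_vdW[OF pr _ _ assms(4) _ True] by blast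
qed

end
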